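(* Let $R$ be an integral domain and let $\Theta$ be a Jaffard family on $R$. Then every $\ast\in\mathrm{Star}(R)$ is extendable to every $T\in\Theta$, and the maps $$\lambda_\Theta\colon \mathrm{Star}(R)\to\prod_{T\in\Theta}\mathrm{Star}(T),\quad \ast\mapsto(\ast_T)_{T\in\Theta},$$ and $$\rho_\Theta\colon \prod_{T\in\Theta}\mathrm{Star}(T)\to\mathrm{Star}(R),\quad (\ast^{(T)})_{T\in\Theta}\mapsto\bigwedge_{T\in\Theta}\ast^{(T)},$$ where $\bigwedge_{T\in\Theta}\ast^{(T)}$ is the map $I\mapsto\bigcap_{T\in\Theta}(IT)^{\ast^{(T)}}$ for every fractional ideal $I$ of $R$, are order-preserving bijections between $\mathrm{Star}(R)$ and $\prod_{T\in\Theta}\mathrm{Star}(T)$.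
   Context: Let $R$ be an integral domain with quotient field $K$. $\mathcal{F}(R)$ is the set of fractional ideals of $R$ (the $R$-submodules $I$ of $K$ with $dI\subseteq R$ for some nonzero $d\in R$). A star operation on $R$ is a map $\ast:\mathcal{F}(R)\to\mathcal{F}(R)$, $I\mapsto I^\ast$, such that for all $I,J\in\mathcal{F}(R)$, $x\in K$: $I\subseteq I^\ast$; $(I^\ast)^\ast=I^\ast$; $I\subseteq J$ implies $I^\ast\subseteq J^\ast$; $R^\ast=R$; $(xI)^\ast=xI^\ast$. $\mathrm{Star}(R)$ is the set of star operations on $R$, ordered by $\ast_1\leq\ast_2$ iff $I^{\ast_1}\subseteq I^{\ast_2}$ for all $I$; products carry the componentwise order. An overring of $R$ is a ring $T$ with $R\subseteq T\subseteq K$. A set $\Theta$ of overrings is locally finite if every nonzero $x\in R$ is a nonunit in only finitely many $T\in\Theta$. A Jaffard family on $R$ is a set $\Theta$ of overrings of $R$ with $K\notin\Theta$ such that: $R=\bigcap_{T\in\Theta}T$; $\Theta$ is locally finite; and, for every nonzero integral ideal $I$ of $R$, $I=\prod_{T\in\Theta}(IT\cap R)$ (a finite product, since $IT=T$ for all but finitely many $T$) and $(IT\cap R)+(IS\cap R)=R$ for all $T\neq S$ in $\Theta$. Members of a Jaffard family are flat over $R$. For a flat overring $T$ of $R$ (every fractional ideal of $T$ is then of the form $IT$ with $I\in\mathcal{F}(R)$), a star operation $\ast\in\mathrm{Star}(R)$ is extendable to $T$ if the map $\ast_T:\mathcal{F}(T)\to\mathcal{F}(T)$, $IT\mapsto I^\ast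 T$ ($I\in\mathcal{F}(R)$), is well-defined; in that case $\ast_T$ is a star operation on $T$. *)

theory Defs
  imports
    "HOL-Library.FuncSet"
    "HOL-Library.Set_Algebras"
    "HOL-Computational_Algebra.Group_Closure"
begin

text \<open>
  The ambient type \<open>'a\<close> of class \<open>field\<close> is the quotient field \<open>K\<close>; the domain \<open>R\<close>, its overrings
  and its fractional ideals are subsets of \<open>'a\<close>.  A subring of a field is automatically an
  integral domain.
\<close>

definition subring_of_field :: "'a::field set \<Rightarrow> bool" where
  "subring_of_field R \<longleftrightarrow> 0 \<in> R \<and> 1 \<in> R \<and>
     (\<forall>x\<in>R. \<forall>y\<in>R. x + y \<in> R \<and> x - y \<in> R \<and> x * y \<in> R)"

definition domain_with_quotient_field_UNIV :: "'a::field set \<Rightarrow> bool" where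
  "domain_with_quotient_field_UNIV R \<longleftrightarrow> subring_of_field R \<and>
     (\<forall>x. \<exists>a\<in>R. \<exists>b\<in>R. b \<noteq> 0 \<and> x = a / b)"

definition overring :: "'a::field set \<Rightarrow> 'a set \<Rightarrow> bool" where
  "overring R T \<longleftrightarrow> subring_of_field T \<and> R \<subseteq> T"

definition submodule_over :: "'a::field set \<Rightarrow> 'a set \<Rightarrow> bool" where
  "submodule_over R I \<longleftrightarrow> 0 \<in> I \<and> (\<forall>x\<in>I. \<forall>y\<in>I. x + y \<in> I) \<and> (\<forall>r\<in>R. \<forall>x\<in>I. r * x \<in> I)"

definition fractional_ideals :: "'a::field set \<Rightarrow> 'a set set" where
  "fractional_ideals R = {I. submodule_over R I \<and> (\<exists>d\<in>R. d \<noteq> 0 \<and> d *o I \<subseteq> R)}"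

definition integral_ideal :: "'a::field set \<Rightarrow> 'a set \<Rightarrow> bool" where
  "integral_ideal R I \<longleftrightarrow> submodule_over R I \<and> I \<subseteq> R"

text \<open>
  On sets, the operation \<open>*\<close> of \<^theory>\<open>HOL-Library.Set_Algebras\<close> is the elementwise product; the
  product of modules consists of the finite sums of such products.  In particular, for an
  overring \<open>T\<close> of \<open>R\<close>, \<open>I \<cdot> T\<close> is the \<open>T\<close>-module generated by the \<open>R\<close>-module \<open>I\<close>.
\<close>

definition module_mult :: "'a::field set \<Rightarrow> 'a set \<Rightarrow> 'a set"  (infixl "\<cdot>" 70) where
  "I \<cdot> J = group_closure (I * J)"

text \<open>
  Product of a finite family of ideals of \<open>R\<close>: the ideal generated by the elementwise product.
  The factor \<open>R\<close> makes the empty product equal to \<open>R\<close>.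
\<close>

definition ideal_family_prod :: "'a::field set \<Rightarrow> ('b \<Rightarrow> 'a set) \<Rightarrow> 'b set \<Rightarrow> 'a set" where
  "ideal_family_prod R A S = R \<cdot> (\<Prod>s\<in>S. A s)"

definition locally_finite_family :: "'a::field set \<Rightarrow> 'a set set \<Rightarrow> bool" where
  "locally_finite_family R \<Theta> \<longleftrightarrow>
     (\<forall>x\<in>R. x \<noteq> 0 \<longrightarrow> finite {T \<in> \<Theta>. \<not> (\<exists>y\<in>T. x * y = 1)})"

text \<open>
  In the ideal factorization, the factors with \<open>I \<cdot> T = T\<close> equal \<open>R\<close> and are omitted; by
  local finiteness, only finitely many remain when \<open>I \<noteq> {0}\<close>.
\<close>

definition jaffard_family :: "'a::field set \<Rightarrow> 'a set set \<Rightarrow> bool" where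
  "jaffard_family R \<Theta> \<longleftrightarrow>
     (\<forall>T\<in>\<Theta>. overring R T) \<and> UNIV \<notin> \<Theta> \<and>
     R = \<Inter>\<Theta> \<and>
     locally_finite_family R \<Theta> \<and>
     (\<forall>I. integral_ideal R I \<and> I \<noteq> {0} \<longrightarrow>
        I = ideal_family_prod R (\<lambda>T. I \<cdot> T \<inter> R) {T \<in> \<Theta>. I \<cdot> T \<noteq> T} \<and>
        (\<forall>T\<in>\<Theta>. \<forall>S\<in>\<Theta>. T \<noteq> S \<longrightarrow> (I \<cdot> T \<inter> R) + (I \<cdot> S \<inter> R) = R))"

text \<open>
  Maps defined on \<open>\<F>(R)\<close> are represented by extensional functions (value \<open>undefined\<close> outside
  \<open>\<F>(R)\<close>), so that equality in \<open>Star R\<close> is equality of maps on \<open>\<F>(R)\<close>.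
\<close>

definition Star :: "'a::field set \<Rightarrow> ('a set \<Rightarrow> 'a set) set" where
  "Star R = {s \<in> fractional_ideals R \<rightarrow>\<^sub>E fractional_ideals R.
     (\<forall>I\<in>fractional_ideals R. I \<subseteq> s I \<and> s (s I) = s I) \<and>
     (\<forall>I\<in>fractional_ideals R. \<forall>J\<in>fractional_ideals R. I \<subseteq> J \<longrightarrow> s I \<subseteq> s J) \<and>
     s R = R \<and>
     (\<forall>I\<in>fractional_ideals R. \<forall>x. s (x *o I) = x *o s I)}"

definition star_le :: "'a::field set \<Rightarrow> ('a set \<Rightarrow> 'a set) \<Rightarrow> ('a set \<Rightarrow> 'a set) \<Rightarrow> bool" where
  "star_le R s t \<longleftrightarrow> (\<forall>I\<in>fractional_ideals R. s I \<subseteq> t I)"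

definition star_prod :: "'a::field set set \<Rightarrow> ('a set \<Rightarrow> 'a set \<Rightarrow> 'a set) set" where
  "star_prod \<Theta> = (\<Pi>\<^sub>E T\<in>\<Theta>. Star T)"

definition star_prod_le ::
    "'a::field set set \<Rightarrow> ('a set \<Rightarrow> 'a set \<Rightarrow> 'a set) \<Rightarrow> ('a set \<Rightarrow> 'a set \<Rightarrow> 'a set) \<Rightarrow> bool" where
  "star_prod_le \<Theta> p q \<longleftrightarrow> (\<forall>T\<in>\<Theta>. star_le T (p T) (q T))"

text \<open>Well-definedness of the assignment \<open>I \<cdot> T \<mapsto> s I \<cdot> T\<close>.\<close>

definition extendable :: "'a::field set \<Rightarrow> 'a set \<Rightarrow> ('a set \<Rightarrow> 'a set) \<Rightarrow> bool" where
  "extendable R T s \<longleftrightarrow>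
     (\<forall>I\<in>fractional_ideals R. \<forall>J\<in>fractional_ideals R. I \<cdot> T = J \<cdot> T \<longrightarrow> s I \<cdot> T = s J \<cdot> T)"

definition star_extension :: "'a::field set \<Rightarrow> 'a set \<Rightarrow> ('a set \<Rightarrow> 'a set) \<Rightarrow> 'a set \<Rightarrow> 'a set" where
  "star_extension R T s =
     (\<lambda>J\<in>fractional_ideals T. THE L. \<exists>I\<in>fractional_ideals R. J = I \<cdot> T \<and> L = s I \<cdot> T)"

definition lambda_map ::
    "'a::field set \<Rightarrow> 'a set set \<Rightarrow> ('a set \<Rightarrow> 'a set) \<Rightarrow> ('a set \<Rightarrow> 'a set \<Rightarrow> 'a set)" where
  "lambda_map R \<Theta> s = (\<lambda>T\<in>\<Theta>. star_extension R T s)"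

text \<open>
  The family \<open>\<Theta>\<close> can be empty only if \<open>R = K\<close>, where the identity is the only star operation.
  An empty intersection of fractional ideals has no intrinsic meaning, and the HOL value
  \<open>\<Inter>{} = UNIV\<close> would not even fix the zero ideal; the empty meet is taken to be the identity,
  which is also the top element of \<open>Star K\<close>.
\<close>

definition rho_map ::
    "'a::field set \<Rightarrow> 'a set set \<Rightarrow> ('a set \<Rightarrow> 'a set \<Rightarrow> 'a set) \<Rightarrow> ('a set \<Rightarrow> 'a set)" where
  "rho_map R \<Theta> p =
     (\<lambda>I\<in>fractional_ideals R. if \<Theta> = {} then I else \<Inter>T\<in>\<Theta>. p T (I \<cdot> T))"

end

theory Submission
  imports Defs
begin

text \<open>
  The key fact is that, for \<open>T \<in> \<Theta>\<close> and a nonzero integral ideal \<open>I\<close>, the product \<open>B\<close> of the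
  contractions \<open>I \<cdot> S \<inter> R\<close> with \<open>S \<noteq> T\<close> generates the unit ideal of \<open>T\<close> and satisfies
  \<open>(I \<cdot> T \<inter> R) B \<subseteq> I\<close>.  After clearing denominators, \<open>I \<subseteq> J \<cdot> T\<close> yields a set \<open>B\<close> with
  \<open>I B \<subseteq> J\<close> and \<open>B \<cdot> T = T\<close>; a star operation \<open>s\<close> then satisfies \<open>s I B \<subseteq> s J\<close>, hence
  \<open>s I \<cdot> T \<subseteq> s J \<cdot> T\<close>, which gives extendability and the monotonicity of the extension.  The
  same sets \<open>B\<close> show that every fractional ideal \<open>J\<close> is the intersection of the \<open>J \<cdot> T\<close>, so that
  \<open>\<rho> \<circ> \<lambda>\<close> is the identity, and that the meet of a family of star operations extends to \<open>T\<close> as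
  its \<open>T\<close>-component, so that \<open>\<lambda> \<circ> \<rho>\<close> is the identity.
\<close>

section \<open>Spans over a subring\<close>

lemma set_scale_iff: "y \<in> x *o I \<longleftrightarrow> (\<exists>i\<in>I. y = x * i)"
  by (auto simp: elt_set_times_def)

lemma subring_uminus: "subring_of_field R \<Longrightarrow> x \<in> R \<Longrightarrow> - x \<in> R"
  unfolding subring_of_field_def by (metis diff_0)

lemma submodule_diff:
  assumes "subring_of_field R" "submodule_over R I" "x \<in> I" "y \<in> I"
  shows "x - y \<in> I"
proof -
  have "- 1 \<in> R" using assms(1) subring_uminus[of R 1] by (auto simp: subring_of_field_def)
  then have "- 1 * y \<in> I" using assms by (auto simp: submodule_over_def)
  then show ?thesis using assms unfolding submodule_over_def
    by (metis mult_minus1 uminus_add_conv_diff add.commute)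
qed

lemma submodule_subring: "subring_of_field T \<Longrightarrow> submodule_over T T"
  by (auto simp: subring_of_field_def submodule_over_def)

lemma submodule_mult_left: "submodule_over R I \<Longrightarrow> r \<in> R \<Longrightarrow> x \<in> I \<Longrightarrow> r * x \<in> I"
  and submodule_mult_right: "submodule_over R I \<Longrightarrow> r \<in> R \<Longrightarrow> x \<in> I \<Longrightarrow> x * r \<in> I"
  by (auto simp: submodule_over_def mult.commute[of _ r])

lemma submodule_restrict: "submodule_over T I \<Longrightarrow> R \<subseteq> T \<Longrightarrow> submodule_over R I"
  by (auto simp: submodule_over_def)

lemma submodule_Int: "submodule_over R I \<Longrightarrow> submodule_over R J \<Longrightarrow> submodule_over R (I \<inter> J)"
  by (auto simp: submodule_over_def)

lemma submodule_scale:
  assumes "submodule_over R I"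
  shows "submodule_over R (x *o I)"
  unfolding submodule_over_def
proof (intro conjI ballI)
  show "0 \<in> x *o I" using assms by (auto simp: submodule_over_def set_scale_iff intro: bexI[of _ 0])
  show "a + b \<in> x *o I" if ab: "a \<in> x *o I" "b \<in> x *o I" for a b
  proof -
    from ab obtain a' b' where "a' \<in> I" "b' \<in> I" "a = x * a'" "b = x * b'"
      by (auto simp: set_scale_iff)
    then have "a' + b' \<in> I" "a + b = x * (a' + b')"
      using assms by (auto simp: submodule_over_def algebra_simps)
    then show ?thesis by (auto simp: set_scale_iff)
  qed
  show "r * a \<in> x *o I" if "r \<in> R" "a \<in> x *o I" for r a
  proof -
    from that obtain a' where "a' \<in> I" "a = x * a'"
      by (auto simp: set_scale_iff)
    then have "r * a' \<in> I" "r * a = x * (r * a')"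
      using assms that by (auto simp: submodule_over_def algebra_simps)
    then show ?thesis by (auto simp: set_scale_iff)
  qed
qed

lemma submodule_mult:
  assumes "subring_of_field T"
  shows "submodule_over T (X \<cdot> T)"
  unfolding submodule_over_def module_mult_def
proof (intro conjI ballI)
  show "t * x \<in> group_closure (X * T)" if t: "t \<in> T" and "x \<in> group_closure (X * T)" for t x
    using that(2)
  proof induction
    case (base s)
    show ?case
    \<comment> \<open>The base rule of \<open>group_closure\<close> also admits 0, which need not be
      a product (\<open>X\<close> may be empty), so 0 is treated apart.\<close>
    proof (cases "s = 0")
      case False
      then obtain a u where "a \<in> X" "u \<in> T" "s = a * u"
        using base by (auto elim: set_times_elim)
      then have "t * s = a * (t * u)" "t * u \<in> T"
        using assms t by (auto simp: subring_of_field_def)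
      then have "t * s \<in> X * T" using \<open>a \<in> X\<close> by (metis set_times_intro)
      then show ?thesis by (simp add: group_closure.base)
    qed simp
  next
    case (diff s u)
    then show ?case by (simp add: right_diff_distrib group_closure.diff)
  qed
qed (auto intro: group_closure_add)

lemma times_subset_mult: "X * Y \<subseteq> X \<cdot> Y"
  unfolding module_mult_def by (auto intro: group_closure.base)

lemma subset_mult: "subring_of_field T \<Longrightarrow> X \<subseteq> X \<cdot> T"
  unfolding module_mult_def subring_of_field_def
  by (metis group_closure.base insertI2 mult.right_neutral set_times_intro subsetI)

text \<open>With \<open>submodule_mult\<close> and \<open>subset_mult\<close> this characterises
  \<open>X \<cdot> T\<close> as the smallest \<open>T\<close>-submodule containing \<open>X\<close>;
  most later inclusions use this property instead of finite sums.\<close>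

lemma mult_least:
  assumes "subring_of_field T" "submodule_over T L" "X \<subseteq> L"
  shows "X \<cdot> T \<subseteq> L"
proof
  fix x assume "x \<in> X \<cdot> T"
  then have "x \<in> group_closure (X * T)" by (simp add: module_mult_def)
  then show "x \<in> L"
  proof induction
    case (base s)
    then show ?case using assms(2,3)
      by (auto simp: submodule_over_def elim!: set_times_elim intro: submodule_mult_right)
  next
    case (diff s t)
    then show ?case using assms submodule_diff by blast
  qed
qed

lemma mult_mono_left: "subring_of_field T \<Longrightarrow> X \<subseteq> Y \<Longrightarrow> X \<cdot> T \<subseteq> Y \<cdot> T"
  by (meson mult_least submodule_mult subset_mult subset_trans)

lemma mult_submodule_eq:
  "subring_of_field T \<Longrightarrow> submodule_over T L \<Longrightarrow> L \<cdot> T = L"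
  by (simp add: mult_least subset_antisym subset_mult)

lemma zero_mult: "subring_of_field T \<Longrightarrow> {0} \<cdot> T = {0}"
  by (rule mult_submodule_eq) (simp_all add: submodule_over_def)

lemma one_in_mult:
  assumes "subring_of_field T" "1 \<in> X \<cdot> T"
  shows "T \<subseteq> X \<cdot> T"
proof
  fix t assume "t \<in> T"
  then have "t * 1 \<in> X \<cdot> T" using assms submodule_mult unfolding submodule_over_def by blast
  then show "t \<in> X \<cdot> T" by simp
qed

text \<open>The elements \<open>z\<close> with \<open>x * z \<in> L\<close> form a
  \<open>T\<close>-submodule containing \<open>X\<close>, hence containing
  \<open>X \<cdot> T\<close>. The induction makes no division by \<open>x\<close>, so
  \<open>x = 0\<close> is covered.\<close>

lemma scale_mult_subset:
  assumes "subring_of_field T" "x *o X \<subseteq> L" "submodule_over T L"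
  shows "x *o (X \<cdot> T) \<subseteq> L"
proof
  fix y assume "y \<in> x *o (X \<cdot> T)"
  then obtain z where "z \<in> group_closure (X * T)" "y = x * z"
    by (auto simp: set_scale_iff module_mult_def)
  moreover from this(1) have "x * z \<in> L"
  proof induction
    case (base s)
    show ?case
    proof (cases "s = 0")
      case True
      then show ?thesis using assms(3) by (simp add: submodule_over_def)
    next
      case False
      then obtain a u where "a \<in> X" "u \<in> T" "s = a * u"
        using base by (auto elim: set_times_elim)
      then have "x * a \<in> L" and "x * s = u * (x * a)" using assms(2) by auto
      moreover have "u * (x * a) \<in> L"
        using \<open>x * a \<in> L\<close> assms(3) \<open>u \<in> T\<close> by (simp add: submodule_over_def)
      ultimately show ?thesis by (simp only:)
    qed
  next
    case (diff s t)
    then show ?case using submodule_diff[OF assms(1,3)] by (simp add: right_diff_distrib)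
  qed
  ultimately show "y \<in> L" by simp
qed

lemma scale_mult:
  assumes "subring_of_field T"
  shows "x *o (X \<cdot> T) = (x *o X) \<cdot> T"
proof
  show "x *o (X \<cdot> T) \<subseteq> (x *o X) \<cdot> T"
    by (simp add: assms scale_mult_subset submodule_mult subset_mult)
  show "(x *o X) \<cdot> T \<subseteq> x *o (X \<cdot> T)"
    by (simp add: assms mult_least set_times_mono submodule_mult submodule_scale subset_mult)
qed

text \<open>Multiplying \<open>1 \<in> B \<cdot> T\<close> by \<open>x \<in> X\<close> puts
  \<open>x\<close> into \<open>x *o (B \<cdot> T)\<close>, which lies in \<open>Y \<cdot> T\<close>.
  Thus a set \<open>B\<close> generating the unit ideal of \<open>T\<close> can be cancelled after
  extension to \<open>T\<close>.\<close>

lemma subset_mult_if_times_subset: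
  assumes "subring_of_field T" "1 \<in> B \<cdot> T" "X * B \<subseteq> Y"
  shows "X \<subseteq> Y \<cdot> T"
proof
  fix x assume "x \<in> X"
  then have "x *o B \<subseteq> Y \<cdot> T"
    using assms subset_mult by (meson order_trans set_times_mono3)
  then have "x *o (B \<cdot> T) \<subseteq> Y \<cdot> T"
    using assms(1) scale_mult_subset submodule_mult by blast
  moreover have "x * 1 \<in> x *o (B \<cdot> T)" using assms(2) by blast
  ultimately show "x \<in> Y \<cdot> T" by auto
qed

lemma one_in_prod_mult:
  assumes "subring_of_field T" "finite F" "\<And>s. s \<in> F \<Longrightarrow> 1 \<in> A s \<cdot> T"
  shows "1 \<in> (\<Prod>s\<in>F. A s) \<cdot> T"
  using assms(2,3)
proof (induction F rule: finite_induct)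
  case empty
  then show ?case using subset_mult[OF assms(1), of 1] by auto
next
  case (insert s F)
  \<comment> \<open>By the induction hypothesis \<open>prod A F\<close> can be cancelled in
    \<open>T\<close>.\<close>
  have "A s \<subseteq> (A s * prod A F) \<cdot> T"
    using insert subset_mult_if_times_subset[OF assms(1)] by auto
  then have "A s \<cdot> T \<subseteq> (A s * prod A F) \<cdot> T"
    using assms(1) mult_least submodule_mult by blast
  then show ?case using insert by auto
qed

lemma prod_subset_subring:
  assumes "subring_of_field R" "\<And>s. s \<in> F \<Longrightarrow> A s \<subseteq> R"
  shows "(\<Prod>s\<in>F. A s) \<subseteq> R"
  using assms(2)
\<comment> \<open>For infinite \<open>F\<close> the product is by default the set
  \<open>{1}\<close>, which lies in \<open>R\<close>.\<close>
proof (induction F rule: infinite_finite_induct)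
  case (insert s F)
  then have "A s \<subseteq> R" "prod A F \<subseteq> R" by auto
  then have "A s * prod A F \<subseteq> R" using assms(1) unfolding subring_of_field_def
    by (blast elim: set_times_elim)
  then show ?case using insert(1,2) by simp
qed (use assms(1) in \<open>auto simp: subring_of_field_def\<close>)

section \<open>Fractional ideals and star operations\<close>

lemma fractional_submodule: "I \<in> fractional_ideals R \<Longrightarrow> submodule_over R I"
  by (simp add: fractional_ideals_def)

lemma zero_in_fractional: "I \<in> fractional_ideals R \<Longrightarrow> 0 \<in> I"
  by (simp add: fractional_ideals_def submodule_over_def)

lemma integral_fractional:
  assumes "subring_of_field R" "submodule_over R I" "I \<subseteq> R"
  shows "I \<in> fractional_ideals R"
  using assms unfolding fractional_ideals_def subring_of_field_def
  by (auto intro!: bexI[of _ 1])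

lemma zero_fractional: "subring_of_field R \<Longrightarrow> {0} \<in> fractional_ideals R"
  by (rule integral_fractional) (auto simp: submodule_over_def subring_of_field_def)

lemma zero_scale: "0 \<in> I \<Longrightarrow> 0 *o I = {0}" for I :: "'a::field set"
  by (auto simp: elt_set_times_def)

lemma scale_ring_subset: "submodule_over T L \<Longrightarrow> R \<subseteq> T \<Longrightarrow> x \<in> L \<Longrightarrow> x *o R \<subseteq> L"
  unfolding elt_set_times_def by (blast intro: submodule_mult_right)

lemma scale_nonzero: "x \<noteq> 0 \<Longrightarrow> i \<in> I \<Longrightarrow> i \<noteq> 0 \<Longrightarrow> x *o I \<noteq> {0}" for x :: "'a::field"
  by (metis set_times_intro2 singletonD mult_eq_0_iff)

lemma fractional_nonzero:
  assumes "I \<in> fractional_ideals R" "I \<noteq> {0}"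
  obtains i where "i \<in> I" "i \<noteq> 0"
  using assms zero_in_fractional[of I R] by blast

lemma set_scale_iff_divide: "x \<noteq> 0 \<Longrightarrow> y \<in> x *o I \<longleftrightarrow> y / x \<in> I" for x y :: "'a::field"
  by (auto simp: set_scale_iff intro!: bexI[of _ "y / x"])

lemma scale_mono_iff: "x \<noteq> 0 \<Longrightarrow> x *o I \<subseteq> x *o J \<longleftrightarrow> I \<subseteq> J" for x :: "'a::field"
  by (auto simp: elt_set_times_def)

lemma fractional_mult:
  assumes "subring_of_field T" "R \<subseteq> T" "I \<in> fractional_ideals R"
  shows "I \<cdot> T \<in> fractional_ideals T"
proof -
  from assms(3) obtain d where d: "d \<in> R" "d \<noteq> 0" "d *o I \<subseteq> R"
    by (auto simp: fractional_ideals_def)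
  then have "d *o (I \<cdot> T) \<subseteq> T"
    using assms scale_mult_subset submodule_subring by blast
  then show ?thesis
    using assms d submodule_mult by (auto simp: fractional_ideals_def)
qed

lemma StarD:
  assumes "s \<in> Star R" "I \<in> fractional_ideals R"
  shows Star_fractional: "s I \<in> fractional_ideals R"
    and Star_extensive: "I \<subseteq> s I"
    and Star_idem: "s (s I) = s I"
    and Star_scale: "s (x *o I) = x *o s I"
    and Star_mono: "J \<in> fractional_ideals R \<Longrightarrow> I \<subseteq> J \<Longrightarrow> s I \<subseteq> s J"
  using assms by (auto simp: Star_def)

lemma StarI:
  assumes "s \<in> fractional_ideals R \<rightarrow>\<^sub>E fractional_ideals R"
    and "\<And>I. I \<in> fractional_ideals R \<Longrightarrow> I \<subseteq> s I"
    and "\<And>I. I \<in> fractional_ideals R \<Longrightarrow> s (s I) = s I"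
    and "\<And>I J. I \<in> fractional_ideals R \<Longrightarrow> J \<in> fractional_ideals R \<Longrightarrow> I \<subseteq> J \<Longrightarrow> s I \<subseteq> s J"
    and "s R = R"
    and "\<And>I x. I \<in> fractional_ideals R \<Longrightarrow> s (x *o I) = x *o s I"
  shows "s \<in> Star R"
  unfolding Star_def using assms by simp

lemma Star_ring: "s \<in> Star R \<Longrightarrow> s R = R"
  by (simp add: Star_def)

text \<open>At \<open>x = 0\<close> the scaling axiom gives \<open>s {0} = 0 *o s {0}\<close>, and
  the right side is \<open>{0}\<close> because \<open>s {0}\<close> contains 0.\<close>

lemma Star_zero:
  assumes "s \<in> Star R" "subring_of_field R"
  shows "s {0} = {0}"
proof -
  have "s (0 *o {0}) = 0 *o s {0}"
    using Star_scale[OF assms(1) zero_fractional[OF assms(2)]] .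
  moreover have "0 \<in> s {0}"
    using Star_extensive[OF assms(1) zero_fractional[OF assms(2)]] by simp
  ultimately show ?thesis by (simp add: zero_scale)
qed

lemma Star_ext:
  assumes "s \<in> Star R" "t \<in> Star R" "\<And>I. I \<in> fractional_ideals R \<Longrightarrow> s I = t I"
  shows "s = t"
  using assms unfolding Star_def by (auto intro: PiE_ext)

lemma fractional_scale:
  assumes quot: "domain_with_quotient_field_UNIV R" and I: "I \<in> fractional_ideals R"
  shows "x *o I \<in> fractional_ideals R"
proof -
  have R: "subring_of_field R" using quot by (simp add: domain_with_quotient_field_UNIV_def)
  obtain a b where ab: "a \<in> R" "b \<in> R" "b \<noteq> 0" "x = a / b"
    using quot unfolding domain_with_quotient_field_UNIV_def by metis
  obtain d where d: "d \<in> R" "d \<noteq> 0" "d *o I \<subseteq> R"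
    using I by (auto simp: fractional_ideals_def)
  \<comment> \<open>Here \<open>b\<close> clears the denominator of \<open>x\<close> and
    \<open>d\<close> those of \<open>I\<close>:
    \<open>(b * d) * (x * i) = a * (d * i)\<close>.\<close>
  have "(b * d) *o (x *o I) \<subseteq> R"
  proof
    fix y assume "y \<in> (b * d) *o (x *o I)"
    then obtain i where "i \<in> I" "y = b * d * (x * i)" by (auto simp: set_scale_iff)
    then have "y = a * (d * i)" "d * i \<in> R" using ab d by auto
    then show "y \<in> R" using R ab by (simp add: subring_of_field_def)
  qed
  moreover have "b * d \<in> R" "b * d \<noteq> 0" using R ab d by (auto simp: subring_of_field_def)
  ultimately show ?thesis
    using submodule_scale[OF fractional_submodule[OF I]] unfolding fractional_ideals_def by blast
qed

lemma overring_quotient: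
  assumes "domain_with_quotient_field_UNIV R" "overring R T"
  shows "domain_with_quotient_field_UNIV T"
  using assms unfolding domain_with_quotient_field_UNIV_def overring_def by blast

section \<open>Ideals and the overrings of a Jaffard family\<close>

locale jaffard =
  fixes R :: "'a::field set" and \<Theta> :: "'a set set"
  assumes quotient_field: "domain_with_quotient_field_UNIV R"
    and family: "jaffard_family R \<Theta>"
begin

lemma subring: "subring_of_field R"
  using quotient_field by (simp add: domain_with_quotient_field_UNIV_def)

lemma one_in: "1 \<in> R" and times_in: "x \<in> R \<Longrightarrow> y \<in> R \<Longrightarrow> x * y \<in> R"
  using subring by (auto simp: subring_of_field_def)

lemma fraction: obtains a b where "a \<in> R" "b \<in> R" "b \<noteq> 0" "x = a / b"
  using quotient_field unfolding domain_with_quotient_field_UNIV_def by metis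

lemma subring_member: "T \<in> \<Theta> \<Longrightarrow> subring_of_field T"
  and subset_member: "T \<in> \<Theta> \<Longrightarrow> R \<subseteq> T"
  and quotient_member: "T \<in> \<Theta> \<Longrightarrow> domain_with_quotient_field_UNIV T"
  and Inter_members: "\<Inter>\<Theta> = R"
  using family overring_quotient[OF quotient_field] by (auto simp: jaffard_family_def overring_def)

lemma fractional_member: "T \<in> \<Theta> \<Longrightarrow> I \<in> fractional_ideals R \<Longrightarrow> I \<cdot> T \<in> fractional_ideals T"
  using fractional_mult subring_member subset_member by blast

lemma ring_fractional: "R \<in> fractional_ideals R"
  using integral_fractional submodule_subring subring by blast

lemma ring_mult: "T \<in> \<Theta> \<Longrightarrow> R \<cdot> T = T"
  by (meson mult_least one_in one_in_mult subring_member subset_antisym subset_member subset_mult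
      submodule_subring subsetD)

lemma principal_integral: "x \<in> R \<Longrightarrow> integral_ideal R (x *o R)"
  unfolding integral_ideal_def
  using submodule_scale[OF submodule_subring[OF subring]] times_in by (auto simp: set_scale_iff)

text \<open>A nonzero \<open>x \<in> I\<close> is a unit in all but finitely many \<open>T\<close>
  by local finiteness, and wherever it is a unit, \<open>1 \<in> I \<cdot> T\<close>.\<close>

lemma finite_nontrivial:
  assumes "integral_ideal R I" "I \<noteq> {0}"
  shows "finite {T \<in> \<Theta>. I \<cdot> T \<noteq> T}"
proof -
  have "0 \<in> I" "I \<subseteq> R" using assms by (auto simp: integral_ideal_def submodule_over_def)
  then obtain x where x: "x \<in> I" "x \<noteq> 0" "x \<in> R" using assms(2) by blast
  have "{T \<in> \<Theta>. I \<cdot> T \<noteq> T} \<subseteq> {T \<in> \<Theta>. \<not> (\<exists>y\<in>T. x * y = 1)}"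
  proof clarify
    fix T y assume T: "T \<in> \<Theta>" and y: "y \<in> T" "x * y = 1" and ne: "I \<cdot> T \<noteq> T"
    have sub: "submodule_over T (I \<cdot> T)" using T submodule_mult subring_member by blast
    have "x \<in> I \<cdot> T" using x T subset_mult subring_member by blast
    then have "1 \<in> I \<cdot> T" using sub y unfolding submodule_over_def by (metis mult.commute)
    then have "T \<subseteq> I \<cdot> T" using one_in_mult subring_member T by blast
    moreover have "I \<cdot> T \<subseteq> T" using assms(1) T mult_least subring_member subset_member
      submodule_subring unfolding integral_ideal_def by (meson order_trans)
    ultimately show False using ne by simp
  qed
  moreover have "finite {T \<in> \<Theta>. \<not> (\<exists>y\<in>T. x * y = 1)}"
    using family x(2,3) by (simp add: jaffard_family_def locally_finite_family_def)
  ultimately show ?thesis by (rule finite_subset)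
qed

text \<open>Comaximality is applied to the ideal \<open>I \<cdot> S \<inter> R\<close> itself, which is contained in its own
  contraction from \<open>T\<close>.\<close>

lemma contraction_other:
  assumes I: "integral_ideal R I" "I \<noteq> {0}" and TS: "T \<in> \<Theta>" "S \<in> \<Theta>" "T \<noteq> S"
  shows "1 \<in> (I \<cdot> S \<inter> R) \<cdot> T"
proof -
  define J where "J = I \<cdot> S \<inter> R"
  have S: "subring_of_field S" "R \<subseteq> S" using TS subring_member subset_member by auto
  have subm: "submodule_over S (I \<cdot> S)" using S submodule_mult by blast
  then have J: "integral_ideal R J"
    using S submodule_Int submodule_restrict submodule_subring[OF subring]
    unfolding integral_ideal_def J_def by blast
  have "I \<subseteq> J" using I S subset_mult by (auto simp: J_def integral_ideal_def)
  then have "J \<noteq> {0}" using I by (auto simp: integral_ideal_def submodule_over_def)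
  then have comax: "(J \<cdot> T \<inter> R) + (J \<cdot> S \<inter> R) = R"
    using family TS J unfolding jaffard_family_def by blast
  \<comment> \<open>Extending \<open>J\<close> to \<open>S\<close> and contracting again gives
    nothing new, so comaximality splits 1 into an element of \<open>J \<cdot> T\<close> and one of
    \<open>J\<close>.\<close>
  have "J \<cdot> S \<subseteq> I \<cdot> S" using mult_least[OF S(1) subm] by (auto simp: J_def)
  then have JS: "J \<cdot> S \<inter> R \<subseteq> J" by (auto simp: J_def)
  have T: "subring_of_field T" using TS subring_member by blast
  have "1 \<in> (J \<cdot> T \<inter> R) + (J \<cdot> S \<inter> R)" using comax one_in by simp
  then obtain a b where ab: "1 = a + b" "a \<in> J \<cdot> T" "b \<in> J"
    using JS by (blast elim: set_plus_elim)
  then have "b \<in> J \<cdot> T" using subset_mult[OF T] by blast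
  then show ?thesis
    using ab submodule_mult[OF T, of J] unfolding J_def submodule_over_def by metis
qed

lemma complementary_factor:
  assumes I: "integral_ideal R I" "I \<noteq> {0}" and T: "T \<in> \<Theta>"
  obtains B where "B \<subseteq> R" "1 \<in> B \<cdot> T" "(I \<cdot> T \<inter> R) * B \<subseteq> I"
    "\<And>S. S \<in> \<Theta> \<Longrightarrow> S \<noteq> T \<Longrightarrow> B \<subseteq> I \<cdot> S"
proof
  define A where "A S = I \<cdot> S \<inter> R" for S
  define F where "F = {S \<in> \<Theta>. I \<cdot> S \<noteq> S}"
  define B where "B = prod A (F - {T})"
  have fin: "finite F" unfolding F_def using finite_nontrivial I by blast
  have fact: "I = R \<cdot> prod A F"
    using family I unfolding jaffard_family_def ideal_family_prod_def A_def F_def by blast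
  have AR: "A S \<subseteq> R" for S by (auto simp: A_def)
  show BR: "B \<subseteq> R" unfolding B_def using AR by (rule prod_subset_subring[OF subring])
  show "1 \<in> B \<cdot> T" unfolding B_def
    using fin T contraction_other[OF I T]
    by (intro one_in_prod_mult subring_member) (auto simp: A_def F_def)
  have prodI: "R * prod A F \<subseteq> I" using fact times_subset_mult by metis
  have "A T * B \<subseteq> R * prod A F"
  \<comment> \<open>If \<open>T\<close> contributes a factor, splitting it off leaves
    \<open>B\<close>. Otherwise \<open>B\<close> is the whole product, and
    \<open>A T \<subseteq> R\<close> is absorbed by the factor \<open>R\<close>.\<close>
  proof (cases "T \<in> F")
    case True
    then have "A T * B = prod A F" using fin by (simp add: B_def prod.remove)
    moreover have "1 * X \<in> R * prod A F" if "X \<in> prod A F" for X using that one_in by blast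
    ultimately show ?thesis by auto
  next
    case False
    then have "B = prod A F" by (simp add: B_def)
    then show ?thesis using AR by (simp add: set_times_mono2)
  qed
  then show "(I \<cdot> T \<inter> R) * B \<subseteq> I" using prodI by (auto simp: A_def)
  show "B \<subseteq> I \<cdot> S" if S: "S \<in> \<Theta>" "S \<noteq> T" for S
  \<comment> \<open>Either \<open>I \<cdot> S \<inter> R\<close> is one of the factors of
    \<open>B\<close> and the others lie in \<open>S\<close>, or \<open>I \<cdot> S = S\<close>
    already contains \<open>R\<close>.\<close>
  proof (cases "S \<in> F")
    case True
    then have "B = A S * prod A (F - {T} - {S})" using fin S by (simp add: B_def prod.remove)
    moreover have "prod A (F - {T} - {S}) \<subseteq> S"
      using prod_subset_subring[OF subring AR] subset_member[OF S(1)] by (rule subset_trans)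
    moreover have "submodule_over S (I \<cdot> S)" using S submodule_mult subring_member by blast
    ultimately show ?thesis
      by (auto simp: A_def elim!: set_times_elim intro: submodule_mult_right)
  next
    case False
    then show ?thesis using S BR subset_member by (auto simp: F_def)
  qed
qed

section \<open>Complementary factors for fractional ideals and single elements\<close>

lemma common_denominator:
  assumes "I \<in> fractional_ideals R" "J \<in> fractional_ideals R"
  obtains d where "d \<in> R" "d \<noteq> 0" "d *o I \<subseteq> R" "d *o J \<subseteq> R"
proof -
  obtain d e where d: "d \<in> R" "d \<noteq> 0" "d *o I \<subseteq> R" and e: "e \<in> R" "e \<noteq> 0" "e *o J \<subseteq> R"
    using assms by (auto simp: fractional_ideals_def)
  show thesis
  proof (rule that[of "d * e"])
    have "e * (d * i) \<in> R" if "i \<in> I" for i using that d e times_in by blast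
    then show "(d * e) *o I \<subseteq> R" by (auto simp: set_scale_iff mult_ac)
    have "d * (e * j) \<in> R" if "j \<in> J" for j using that d e times_in by blast
    then show "(d * e) *o J \<subseteq> R" by (auto simp: set_scale_iff mult_ac)
  qed (use d e times_in in auto)
qed

text \<open>A common denominator \<open>d\<close> makes both ideals integral. Then
  \<open>d *o I\<close> lies in the contraction of \<open>(d *o J) \<cdot> T\<close>, which the
  complementary factor of \<open>d *o J\<close> carries into \<open>d *o J\<close>, and
  \<open>d\<close> cancels.\<close>

lemma complementary_factor_fractional:
  assumes I: "I \<in> fractional_ideals R" and J: "J \<in> fractional_ideals R" "J \<noteq> {0}"
    and T: "T \<in> \<Theta>" and sub: "I \<subseteq> J \<cdot> T"
  obtains B where "B \<subseteq> R" "1 \<in> B \<cdot> T" "I * B \<subseteq> J"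
proof -
  obtain d where d: "d \<in> R" "d \<noteq> 0" "d *o I \<subseteq> R" "d *o J \<subseteq> R"
    using common_denominator I J by blast
  have int: "integral_ideal R (d *o J)"
    using d J by (simp add: integral_ideal_def fractional_submodule submodule_scale)
  have "d *o J \<noteq> {0}" using fractional_nonzero[OF J] scale_nonzero[OF d(2)] by metis
  then obtain B where B: "B \<subseteq> R" "1 \<in> B \<cdot> T" "((d *o J) \<cdot> T \<inter> R) * B \<subseteq> d *o J"
    using complementary_factor[OF int _ T] by metis
  have "d *o I \<subseteq> (d *o J) \<cdot> T"
    using sub subring_member[OF T] scale_mult set_times_mono by metis
  then have "d *o I \<subseteq> (d *o J) \<cdot> T \<inter> R" using d by simp
  then have "(d *o I) * B \<subseteq> d *o J" using B by (meson order_trans set_times_mono2 order_refl)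
  then have "d *o (I * B) \<subseteq> d *o J" by (simp add: set_times_rearrange3)
  then show thesis using B that d by (simp add: scale_mono_iff)
qed

text \<open>Some nonzero \<open>c \<in> R\<close> carries \<open>x\<close> into \<open>J\<close>, so
  the complementary factor of the principal ideal \<open>c *o R\<close> carries \<open>x\<close>
  into \<open>J \<cdot> S\<close> for each \<open>S\<close> other than \<open>T\<close>. In
  \<open>rho_map_mult\<close> the component at \<open>T\<close> is controlled by the choice of
  \<open>x\<close> itself.\<close>

lemma complementary_factor_element:
  assumes J: "J \<in> fractional_ideals R" "J \<noteq> {0}" and T: "T \<in> \<Theta>"
  obtains B where "B \<subseteq> R" "1 \<in> B \<cdot> T" "\<And>S. S \<in> \<Theta> \<Longrightarrow> S \<noteq> T \<Longrightarrow> x *o B \<subseteq> J \<cdot> S"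
proof -
  obtain j where j: "j \<in> J" "j \<noteq> 0" using J by (rule fractional_nonzero)
  obtain a b where ab: "a \<in> R" "b \<in> R" "b \<noteq> 0" "x = a / b" by (rule fraction)
  obtain a' b' where ab': "a' \<in> R" "b' \<in> R" "b' \<noteq> 0" "j = a' / b'" by (rule fraction)
  \<comment> \<open>Since \<open>x = a / b\<close> and \<open>a' = b' * j\<close>, the product
    \<open>x * c\<close> equals \<open>a * b' * j\<close>, an \<open>R\<close>-multiple of
    \<open>j \<in> J\<close>.\<close>
  define c where "c = a' * b"
  have "a' \<noteq> 0" using ab' j by auto
  then have c: "c \<in> R" "c \<noteq> 0" using ab ab' times_in by (auto simp: c_def)
  have int: "integral_ideal R (c *o R)" using c principal_integral by blast
  have "c *o R \<noteq> {0}" using scale_nonzero[OF c(2) one_in] by simp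
  then obtain B where B: "B \<subseteq> R" "1 \<in> B \<cdot> T"
    "\<And>S. S \<in> \<Theta> \<Longrightarrow> S \<noteq> T \<Longrightarrow> B \<subseteq> (c *o R) \<cdot> S"
    using complementary_factor[OF int _ T] by metis
  show thesis
  proof (rule that[OF B(1,2)])
    fix S assume S: "S \<in> \<Theta>" "S \<noteq> T"
    have sub: "submodule_over S (J \<cdot> S)" using S submodule_mult subring_member by blast
    have "x *o (c *o R) \<subseteq> J \<cdot> S"
    proof
      fix y assume "y \<in> x *o (c *o R)"
      then obtain r where "r \<in> R" "y = x * (c * r)" by (auto simp: set_scale_iff)
      moreover have "x * (c * r) = (a * b' * r) * j"
        using ab(3,4) ab'(3,4) by (simp add: c_def)
      moreover have "a * b' * r \<in> S"
        using times_in[OF times_in[OF ab(1) ab'(2)] \<open>r \<in> R\<close>] subset_member[OF S(1)] by blast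
      moreover have "j \<in> J \<cdot> S" using j subset_mult subring_member S by blast
      ultimately show "y \<in> J \<cdot> S" using sub by (simp add: submodule_mult_left)
    qed
    then have "x *o ((c *o R) \<cdot> S) \<subseteq> J \<cdot> S"
      using scale_mult_subset sub subring_member S by blast
    then show "x *o B \<subseteq> J \<cdot> S" using B(3)[OF S] by (meson order_trans set_times_mono)
  qed
qed

section \<open>Descent of fractional ideals from \<open>T\<close>, and recovery from all
  extensions\<close>

lemma principal_fractional: "x *o R \<in> fractional_ideals R"
  using fractional_scale[OF quotient_field ring_fractional] .

text \<open>After scaling \<open>L\<close> to \<open>M \<subseteq> T\<close>, each
  \<open>x \<in> M\<close> lies in \<open>R \<cdot> T\<close>, so some \<open>B\<close> generating
  the unit ideal of \<open>T\<close> has \<open>x *o B \<subseteq> R\<close>. These products stay in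
  \<open>M\<close>, hence in \<open>M \<inter> R\<close>, and cancelling \<open>B\<close> gives
  \<open>M = (M \<inter> R) \<cdot> T\<close>. This ensures that \<open>star_extension\<close> has a
  candidate value at every fractional ideal of \<open>T\<close>.\<close>

lemma extended_ideal:
  assumes T: "T \<in> \<Theta>" and L: "L \<in> fractional_ideals T"
  obtains I where "I \<in> fractional_ideals R" "L = I \<cdot> T"
proof -
  obtain d where d: "d \<in> T" "d \<noteq> 0" "d *o L \<subseteq> T" using L by (auto simp: fractional_ideals_def)
  define M where "M = d *o L"
  have M: "submodule_over T M" unfolding M_def using L fractional_submodule submodule_scale by blast
  define I where "I = M \<inter> R"
  have I: "submodule_over R I" unfolding I_def
    using M T submodule_Int submodule_restrict submodule_subring[OF subring] subset_member by blast
  have "M \<subseteq> I \<cdot> T"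
  proof
    fix x assume x: "x \<in> M"
    have "x \<in> T" using x d by (auto simp: M_def)
    then have "x *o R \<subseteq> R \<cdot> T"
      unfolding ring_mult[OF T]
      using subset_member[OF T] submodule_subring[OF subring_member[OF T]] scale_ring_subset by blast
    moreover have "R \<noteq> {0}" using one_in by auto
    ultimately obtain B where B: "B \<subseteq> R" "1 \<in> B \<cdot> T" "(x *o R) * B \<subseteq> R"
      using complementary_factor_fractional[OF principal_fractional ring_fractional _ T] by metis
    have "x * 1 \<in> x *o R" using one_in by blast
    then have "x * b \<in> I" if "b \<in> B" for b
      using that B submodule_mult_right[OF M _ x] subset_member[OF T] by (force simp: I_def)
    then have "{x} * B \<subseteq> I" by (auto elim!: set_times_elim)
    then show "x \<in> I \<cdot> T"
      using subset_mult_if_times_subset[OF subring_member[OF T] B(2)] by blast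
  qed
  moreover have "I \<cdot> T \<subseteq> M"
    using mult_least[OF subring_member[OF T] M] by (simp add: I_def)
  ultimately have "M = I \<cdot> T" by blast
  then have "inverse d *o M = (inverse d *o I) \<cdot> T" using scale_mult subring_member T by metis
  moreover have "inverse d *o M = L" using d by (simp add: M_def set_times_rearrange2)
  \<comment> \<open>The scalar \<open>d\<close> is only known to lie in \<open>T\<close>; rescaling
    by it preserves fractional ideals of \<open>R\<close> because every field element is a quotient
    of elements of \<open>R\<close>.\<close>
  moreover have "inverse d *o I \<in> fractional_ideals R"
    using fractional_scale[OF quotient_field] integral_fractional[OF subring I] by (simp add: I_def)
  ultimately show thesis using that by metis
qed

text \<open>If \<open>x\<close> lies in every \<open>J \<cdot> T\<close>, then the conductor of \<open>x\<close> into \<open>J\<close> extends to the unit ideal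
  of every \<open>T\<close>, so that its factorization is the empty product.\<close>

lemma fractional_eq_Inter:
  assumes "\<Theta> \<noteq> {}" and J: "J \<in> fractional_ideals R"
  shows "(\<Inter>T\<in>\<Theta>. J \<cdot> T) = J"
proof (cases "J = {0}")
  case True
  have "{0} \<cdot> T = {0}" if "T \<in> \<Theta>" for T
    using zero_mult[OF subring_member[OF that]] .
  then show ?thesis using True assms(1) by auto
next
  case False
  show ?thesis
  proof
    show "J \<subseteq> (\<Inter>T\<in>\<Theta>. J \<cdot> T)" using subset_mult subring_member by blast
    show "(\<Inter>T\<in>\<Theta>. J \<cdot> T) \<subseteq> J"
    proof
      fix x assume x: "x \<in> (\<Inter>T\<in>\<Theta>. J \<cdot> T)"
      define C where "C = {r \<in> R. r * x \<in> J}"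
      have C: "integral_ideal R C"
        unfolding integral_ideal_def submodule_over_def C_def
        using subring fractional_submodule[OF J]
        by (auto simp: subring_of_field_def submodule_over_def distrib_right mult.assoc)
      have one: "1 \<in> C \<cdot> T" if T: "T \<in> \<Theta>" for T
      proof -
        have sub: "submodule_over T (J \<cdot> T)" using submodule_mult subring_member T by blast
        have "x \<in> J \<cdot> T" using x T by blast
        then have "x *o R \<subseteq> J \<cdot> T" by (rule scale_ring_subset[OF sub subset_member[OF T]])
        then obtain B where B: "B \<subseteq> R" "1 \<in> B \<cdot> T" "(x *o R) * B \<subseteq> J"
          using complementary_factor_fractional[OF principal_fractional J False T] by metis
        have "x * 1 \<in> x *o R" using one_in by blast
        then have "B \<subseteq> C" using B by (force simp: C_def mult.commute)
        then show ?thesis using B mult_mono_left subring_member T by blast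
      qed
      \<comment> \<open>A zero conductor would extend to \<open>{0}\<close> in some member of the
        nonempty family, contradicting \<open>one\<close>.\<close>
      then have nz: "C \<noteq> {0}"
        using assms(1) zero_mult subring_member by (metis all_not_in_conv singletonD zero_neq_one)
      have "C \<cdot> T = T" if T: "T \<in> \<Theta>" for T
      proof
        have "C \<subseteq> T" using subset_member[OF T] by (auto simp: C_def)
        then show "C \<cdot> T \<subseteq> T" using subring_member[OF T] mult_least submodule_subring by blast
        show "T \<subseteq> C \<cdot> T" using one_in_mult[OF subring_member[OF T] one[OF T]] .
      qed
      then have empty: "{T \<in> \<Theta>. C \<cdot> T \<noteq> T} = {}" by blast
      have "C = ideal_family_prod R (\<lambda>T. C \<cdot> T \<inter> R) {T \<in> \<Theta>. C \<cdot> T \<noteq> T}"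
        using family C nz unfolding jaffard_family_def by blast
      then have "C = R \<cdot> 1" unfolding empty ideal_family_prod_def by simp
      \<comment> \<open>In \<open>R * 1\<close> the symbol \<open>1\<close> is the set
        \<open>{1}\<close>, the empty product of sets.\<close>
      moreover have "1 * 1 \<in> R * 1" using one_in by (intro set_times_intro) simp_all
      ultimately have "1 \<in> C" using times_subset_mult by auto
      then show "x \<in> J" by (simp add: C_def)
    qed
  qed
qed

section \<open>Extension and meet of star operations\<close>

lemma Star_mult_mono:
  assumes s: "s \<in> Star R" and I: "I \<in> fractional_ideals R" and J: "J \<in> fractional_ideals R"
    and T: "T \<in> \<Theta>" and sub: "I \<cdot> T \<subseteq> J \<cdot> T"
  shows "s I \<cdot> T \<subseteq> s J \<cdot> T"
proof (cases "J = {0}")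
  case True
  have "{0} \<cdot> T = {0}" using zero_mult[OF subring_member[OF T]] .
  then have "I \<subseteq> {0}" using True sub subset_mult subring_member T by blast
  then have "I = J" using True zero_in_fractional[OF I] by blast
  then show ?thesis by simp
next
  case False
  have "I \<subseteq> J \<cdot> T" using sub subset_mult subring_member T by blast
  then obtain B where B: "B \<subseteq> R" "1 \<in> B \<cdot> T" "I * B \<subseteq> J"
    using complementary_factor_fractional[OF I J False T] by metis
  have "s I * B \<subseteq> s J"
  proof -
    \<comment> \<open>The axioms let \<open>s\<close> commute with scaling by one element, so
      \<open>B\<close> is handled element by element.\<close>
    have "b *o s I \<subseteq> s J" if b: "b \<in> B" for b
    proof -
      have "b *o I \<subseteq> J" using B b by (meson order_trans set_times_mono4)
      then have "s (b *o I) \<subseteq> s J"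
        using Star_mono[OF s fractional_scale[OF quotient_field I] J] by blast
      then show ?thesis using Star_scale[OF s I] by simp
    qed
    then show ?thesis by (force simp: set_scale_iff mult.commute elim!: set_times_elim)
  qed
  then have "s I \<subseteq> s J \<cdot> T" using subset_mult_if_times_subset subring_member T B by blast
  then show ?thesis using mult_least submodule_mult subring_member T by blast
qed

lemma Star_extendable: "s \<in> Star R \<Longrightarrow> T \<in> \<Theta> \<Longrightarrow> extendable R T s"
  unfolding extendable_def using Star_mult_mono by (intro ballI impI equalityI) simp_all

text \<open>Extendability is precisely the uniqueness required by the definite description, with
  \<open>I\<close> itself as witness.\<close>

lemma star_extension_mult:
  assumes s: "s \<in> Star R" and T: "T \<in> \<Theta>" and I: "I \<in> fractional_ideals R"
  shows "star_extension R T s (I \<cdot> T) = s I \<cdot> T"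
proof -
  have "(THE L. \<exists>I'\<in>fractional_ideals R. I \<cdot> T = I' \<cdot> T \<and> L = s I' \<cdot> T) = s I \<cdot> T"
    using Star_extendable[OF s T] I unfolding extendable_def by (intro the_equality) blast+
  then show ?thesis unfolding star_extension_def using fractional_member[OF T I] by simp
qed

text \<open>Writing each fractional ideal of \<open>T\<close> as \<open>I \<cdot> T\<close> reduces
  the axioms to those of \<open>s\<close>. Monotonicity is subtler:
  \<open>I \<cdot> T \<subseteq> J \<cdot> T\<close> does not give \<open>I \<subseteq> J\<close>,
  so it rests on \<open>Star_mult_mono\<close>.\<close>

lemma star_extension_Star:
  assumes s: "s \<in> Star R" and T: "T \<in> \<Theta>"
  shows "star_extension R T s \<in> Star T"
proof -
  let ?e = "star_extension R T s"
  note ext = star_extension_mult[OF s T]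
  have frac: "s I \<in> fractional_ideals R" if "I \<in> fractional_ideals R" for I
    using Star_fractional[OF s that] .
  show ?thesis
  proof (rule StarI)
    show "?e \<in> fractional_ideals T \<rightarrow>\<^sub>E fractional_ideals T"
    proof
      fix L assume "L \<in> fractional_ideals T"
      then obtain I where I: "I \<in> fractional_ideals R" "L = I \<cdot> T" by (rule extended_ideal[OF T])
      then show "?e L \<in> fractional_ideals T" using ext frac fractional_member[OF T] by simp
    qed (simp add: star_extension_def)
    have "L \<subseteq> ?e L \<and> ?e (?e L) = ?e L" if "L \<in> fractional_ideals T" for L
    proof -
      from that obtain I where I: "I \<in> fractional_ideals R" "L = I \<cdot> T" by (rule extended_ideal[OF T])
      then show ?thesis
        using ext frac Star_idem[OF s I(1)] Star_extensive[OF s I(1)]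
          mult_mono_left[OF subring_member[OF T]] by auto
    qed
    then show "L \<subseteq> ?e L" "?e (?e L) = ?e L" if "L \<in> fractional_ideals T" for L
      using that by blast+
    show "?e L \<subseteq> ?e M"
      if LM: "L \<in> fractional_ideals T" "M \<in> fractional_ideals T" "L \<subseteq> M" for L M
    proof -
      obtain I where I: "I \<in> fractional_ideals R" "L = I \<cdot> T" by (rule extended_ideal[OF T LM(1)])
      obtain J where J: "J \<in> fractional_ideals R" "M = J \<cdot> T" by (rule extended_ideal[OF T LM(2)])
      show ?thesis using I J LM(3) ext Star_mult_mono[OF s I(1) J(1) T] by simp
    qed
    show "?e T = T"
      using ext[OF ring_fractional] Star_ring[OF s] ring_mult[OF T] by simp
    show "?e (x *o L) = x *o ?e L" if "L \<in> fractional_ideals T" for L x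
    proof -
      from that obtain I where I: "I \<in> fractional_ideals R" "L = I \<cdot> T" by (rule extended_ideal[OF T])
      have "?e (x *o L) = s (x *o I) \<cdot> T"
        using I ext[OF fractional_scale[OF quotient_field I(1)]] scale_mult[OF subring_member[OF T]]
        by simp
      also have "\<dots> = x *o ?e L"
        using I ext Star_scale[OF s I(1)] scale_mult[OF subring_member[OF T]] by simp
      finally show ?thesis .
    qed
  qed
qed

lemma lambda_map_star_prod: "s \<in> Star R \<Longrightarrow> lambda_map R \<Theta> s \<in> star_prod \<Theta>"
  unfolding lambda_map_def star_prod_def using star_extension_Star by (simp add: restrict_PiE_iff)

lemma lambda_map_mono:
  "monotone_on (Star R) (star_le R) (star_prod_le \<Theta>) (lambda_map R \<Theta>)"
proof (rule monotone_onI)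
  fix s t assume s: "s \<in> Star R" and t: "t \<in> Star R" and le: "star_le R s t"
  have "star_extension R T s L \<subseteq> star_extension R T t L"
    if T: "T \<in> \<Theta>" and L: "L \<in> fractional_ideals T" for T L
  proof -
    obtain I where I: "I \<in> fractional_ideals R" "L = I \<cdot> T" by (rule extended_ideal[OF T L])
    then show ?thesis
      using le star_extension_mult[OF s T] star_extension_mult[OF t T]
        mult_mono_left[OF subring_member[OF T]] by (auto simp: star_le_def)
  qed
  then show "star_prod_le \<Theta> (lambda_map R \<Theta> s) (lambda_map R \<Theta> t)"
    by (auto simp: star_prod_le_def star_le_def lambda_map_def)
qed

section \<open>The meet of a family of star operations\<close>

lemma rho_map_mono:
  "monotone_on (star_prod \<Theta>) (star_prod_le \<Theta>) (star_le R) (rho_map R \<Theta>)"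
proof (rule monotone_onI)
  fix p q assume le: "star_prod_le \<Theta> p q"
  have "(\<Inter>T\<in>\<Theta>. p T (I \<cdot> T)) \<subseteq> (\<Inter>T\<in>\<Theta>. q T (I \<cdot> T))" if "I \<in> fractional_ideals R" for I
    using le fractional_member[OF _ that] unfolding star_prod_le_def star_le_def by blast
  then show "star_le R (rho_map R \<Theta> p) (rho_map R \<Theta> q)"
    by (auto simp: star_le_def rho_map_def)
qed

lemma star_prod_member: "p \<in> star_prod \<Theta> \<Longrightarrow> T \<in> \<Theta> \<Longrightarrow> p T \<in> Star T"
  by (auto simp: star_prod_def)

lemma rho_map_apply:
  "I \<in> fractional_ideals R \<Longrightarrow> \<Theta> \<noteq> {} \<Longrightarrow> rho_map R \<Theta> p I = (\<Inter>T\<in>\<Theta>. p T (I \<cdot> T))"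
  by (simp add: rho_map_def)

text \<open>A single denominator \<open>d\<close> of \<open>I\<close> serves all components:
  applying \<open>p T\<close> to \<open>d *o (I \<cdot> T) \<subseteq> T\<close> gives
  \<open>d *o p T (I \<cdot> T) \<subseteq> T\<close>, and the members of the family intersect in
  \<open>R\<close>.\<close>

lemma rho_map_fractional:
  assumes p: "p \<in> star_prod \<Theta>" and I: "I \<in> fractional_ideals R"
  shows "rho_map R \<Theta> p I \<in> fractional_ideals R"
proof (cases "\<Theta> = {}")
  case True
  then show ?thesis using I by (simp add: rho_map_def)
next
  case False
  have "submodule_over R (p T (I \<cdot> T))" if T: "T \<in> \<Theta>" for T
    using Star_fractional[OF star_prod_member[OF p T] fractional_member[OF T I]]
      fractional_submodule submodule_restrict subset_member[OF T] by blast
  then have sub: "submodule_over R (\<Inter>T\<in>\<Theta>. p T (I \<cdot> T))"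
    unfolding submodule_over_def by auto
  obtain d where d: "d \<in> R" "d \<noteq> 0" "d *o I \<subseteq> R" using I by (auto simp: fractional_ideals_def)
  have "d *o p T (I \<cdot> T) \<subseteq> T" if T: "T \<in> \<Theta>" for T
  proof -
    note st = star_prod_member[OF p T]
    have IT: "I \<cdot> T \<in> fractional_ideals T" using fractional_member T I by blast
    have TT: "T \<in> fractional_ideals T"
      using integral_fractional submodule_subring subring_member T by blast
    have "d *o (I \<cdot> T) \<subseteq> T"
      using scale_mult_subset[OF subring_member[OF T] _ submodule_subring] d T
        subring_member subset_member by blast
    then have "p T (d *o (I \<cdot> T)) \<subseteq> p T T"
      using Star_mono[OF st fractional_scale[OF quotient_member[OF T] IT] TT] by blast
    then show ?thesis using Star_scale[OF st IT] Star_ring[OF st] by simp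
  qed
  then have "d *o (\<Inter>T\<in>\<Theta>. p T (I \<cdot> T)) \<subseteq> \<Inter>\<Theta>" by (force simp: set_scale_iff)
  then show ?thesis using d sub rho_map_apply[OF I False] Inter_members
    unfolding fractional_ideals_def by auto
qed

lemma rho_map_mult_subset:
  assumes p: "p \<in> star_prod \<Theta>" and I: "I \<in> fractional_ideals R" and T: "T \<in> \<Theta>"
  shows "rho_map R \<Theta> p I \<cdot> T \<subseteq> p T (I \<cdot> T)"
proof (rule mult_least[OF subring_member[OF T]])
  show "submodule_over T (p T (I \<cdot> T))"
    using Star_fractional[OF star_prod_member[OF p T] fractional_member[OF T I]]
      fractional_submodule by blast
  show "rho_map R \<Theta> p I \<subseteq> p T (I \<cdot> T)" using rho_map_apply[OF I] T by auto
qed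

lemma rho_map_scale:
  assumes p: "p \<in> star_prod \<Theta>" and I: "I \<in> fractional_ideals R" and ne: "\<Theta> \<noteq> {}"
  shows "rho_map R \<Theta> p (x *o I) = x *o rho_map R \<Theta> p I"
proof -
  have eq: "p T ((x *o I) \<cdot> T) = x *o p T (I \<cdot> T)" if T: "T \<in> \<Theta>" for T
    using Star_scale[OF star_prod_member[OF p T] fractional_member[OF T I]]
      scale_mult[OF subring_member[OF T]] by metis
  have "x *o (\<Inter>T\<in>\<Theta>. p T (I \<cdot> T)) = (\<Inter>T\<in>\<Theta>. x *o p T (I \<cdot> T))"
  \<comment> \<open>Multiplication by a nonzero \<open>x\<close> is a bijection and commutes with
    intersections. For \<open>x = 0\<close> both sides are \<open>{0}\<close>, the right one because
    the family is nonempty.\<close>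
  proof (cases "x = 0")
    case True
    have "0 \<in> p T (I \<cdot> T)" if T: "T \<in> \<Theta>" for T
      using Star_fractional[OF star_prod_member[OF p T] fractional_member[OF T I]]
        zero_in_fractional by blast
    then show ?thesis using ne True by (simp add: zero_scale)
  next
    case False
    then show ?thesis by (simp add: set_eq_iff set_scale_iff_divide)
  qed
  then show ?thesis
    using rho_map_apply[OF I ne, of p] eq rho_map_apply[OF fractional_scale[OF quotient_field I] ne, of p x]
    by simp
qed

lemma rho_map_Star:
  assumes p: "p \<in> star_prod \<Theta>"
  shows "rho_map R \<Theta> p \<in> Star R"
proof (cases "\<Theta> = {}")
  case True
  then show ?thesis using ring_fractional fractional_scale[OF quotient_field]
    by (simp add: Star_def rho_map_def)
next
  case False
  let ?s = "rho_map R \<Theta> p"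
  have maps: "?s \<in> fractional_ideals R \<rightarrow>\<^sub>E fractional_ideals R"
    using rho_map_fractional[OF p] by (auto simp: rho_map_def)
  have ext: "I \<subseteq> ?s I" if I: "I \<in> fractional_ideals R" for I
    unfolding rho_map_apply[OF I False]
  proof (rule INT_greatest)
    fix T assume T: "T \<in> \<Theta>"
    then show "I \<subseteq> p T (I \<cdot> T)"
      using Star_extensive[OF star_prod_member[OF p T] fractional_member[OF T I]]
        subset_mult[OF subring_member[OF T]] by (meson order_trans)
  qed
  have mono: "?s I \<subseteq> ?s J"
    if I: "I \<in> fractional_ideals R" and J: "J \<in> fractional_ideals R" and "I \<subseteq> J" for I J
  proof -
    have "p T (I \<cdot> T) \<subseteq> p T (J \<cdot> T)" if T: "T \<in> \<Theta>" for T
      using Star_mono[OF star_prod_member[OF p T] fractional_member[OF T I] fractional_member[OF T J]]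
        mult_mono_left[OF subring_member[OF T] \<open>I \<subseteq> J\<close>] by blast
    then show ?thesis
      unfolding rho_map_apply[OF I False] rho_map_apply[OF J False] by (rule INF_superset_mono[OF subset_refl])
  qed
  have idem: "?s (?s I) = ?s I" if I: "I \<in> fractional_ideals R" for I
  proof
    note sI = rho_map_fractional[OF p I]
    show "?s I \<subseteq> ?s (?s I)" using ext[OF sI] .
    \<comment> \<open>The ideal \<open>p T (I \<cdot> T)\<close> contains
      \<open>?s I \<cdot> T\<close> and is fixed by \<open>p T\<close>.\<close>
    have "p T (?s I \<cdot> T) \<subseteq> p T (I \<cdot> T)" if T: "T \<in> \<Theta>" for T
      using Star_mono[OF star_prod_member[OF p T] fractional_member[OF T sI]
          Star_fractional[OF star_prod_member[OF p T] fractional_member[OF T I]]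
          rho_map_mult_subset[OF p I T]]
        Star_idem[OF star_prod_member[OF p T] fractional_member[OF T I]] by simp
    then have "(\<Inter>T\<in>\<Theta>. p T (?s I \<cdot> T)) \<subseteq> (\<Inter>T\<in>\<Theta>. p T (I \<cdot> T))"
      by (rule INF_superset_mono[OF subset_refl])
    then show "?s (?s I) \<subseteq> ?s I"
      using rho_map_apply[OF sI False, of p] rho_map_apply[OF I False, of p] by simp
  qed
  have "p T (R \<cdot> T) = T" if T: "T \<in> \<Theta>" for T
    using ring_mult[OF T] Star_ring[OF star_prod_member[OF p T]] by simp
  then have "?s R = R" using rho_map_apply[OF ring_fractional False] Inter_members by simp
  then show ?thesis using maps ext idem mono rho_map_scale[OF p _ False] by (intro StarI)
qed

text \<open>For \<open>x\<close> in the component at \<open>T\<close>, take \<open>B\<close> with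
  \<open>x *o B \<subseteq> I \<cdot> S\<close> for all other \<open>S\<close>. Then
  \<open>x * b\<close> lies in every component: at \<open>T\<close> by the module property,
  elsewhere by extensivity. Cancelling \<open>B\<close> in \<open>T\<close> returns
  \<open>x\<close>.\<close>

lemma rho_map_mult:
  assumes p: "p \<in> star_prod \<Theta>" and I: "I \<in> fractional_ideals R" and T: "T \<in> \<Theta>"
  shows "rho_map R \<Theta> p I \<cdot> T = p T (I \<cdot> T)"
proof
  note st = star_prod_member[OF p]
  show "rho_map R \<Theta> p I \<cdot> T \<subseteq> p T (I \<cdot> T)" using rho_map_mult_subset[OF p I T] .
  show "p T (I \<cdot> T) \<subseteq> rho_map R \<Theta> p I \<cdot> T"
  proof (cases "I = {0}")
    case True
    have "{0} \<cdot> T = {0}" using zero_mult[OF subring_member[OF T]] .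
    then show ?thesis
      using True Star_zero[OF st[OF T] subring_member[OF T]] submodule_mult[OF subring_member[OF T]]
      by (simp add: submodule_over_def)
  next
    case False
    show ?thesis
    proof
      fix x assume x: "x \<in> p T (I \<cdot> T)"
      obtain B where B: "B \<subseteq> R" "1 \<in> B \<cdot> T"
        "\<And>S. S \<in> \<Theta> \<Longrightarrow> S \<noteq> T \<Longrightarrow> x *o B \<subseteq> I \<cdot> S"
        using complementary_factor_element[OF I False T, where x=x] by metis
      have "x * b \<in> p S (I \<cdot> S)" if b: "b \<in> B" and S: "S \<in> \<Theta>" for b S
      proof (cases "S = T")
        case True
        have "submodule_over T (p T (I \<cdot> T))"
          using Star_fractional[OF st[OF T] fractional_member[OF T I]] fractional_submodule by blast
        moreover have "b \<in> T" using b B subset_member[OF T] by blast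
        ultimately show ?thesis using x True by (simp add: submodule_mult_right)
      next
        case False
        then show ?thesis
          using b B(3)[OF S] Star_extensive[OF st[OF S] fractional_member[OF S I]]
          by (auto simp: set_scale_iff)
      qed
      then have "{x} * B \<subseteq> rho_map R \<Theta> p I"
        using rho_map_apply[OF I, of p] T by (auto elim!: set_times_elim)
      then show "x \<in> rho_map R \<Theta> p I \<cdot> T"
        using subset_mult_if_times_subset[OF subring_member[OF T] B(2)] by blast
    qed
  qed
qed

section \<open>The two maps are mutually inverse\<close>

lemma lambda_rho:
  assumes p: "p \<in> star_prod \<Theta>"
  shows "lambda_map R \<Theta> (rho_map R \<Theta> p) = p"
proof
  fix T
  show "lambda_map R \<Theta> (rho_map R \<Theta> p) T = p T"
  proof (cases "T \<in> \<Theta>")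
    case T: True
    have "star_extension R T (rho_map R \<Theta> p) = p T"
    proof (rule Star_ext)
      fix L assume "L \<in> fractional_ideals T"
      then obtain I where I: "I \<in> fractional_ideals R" "L = I \<cdot> T" by (rule extended_ideal[OF T])
      then show "star_extension R T (rho_map R \<Theta> p) L = p T L"
        using star_extension_mult[OF rho_map_Star[OF p] T I(1)] rho_map_mult[OF p I(1) T] by simp
    qed (use star_extension_Star rho_map_Star star_prod_member p T in blast)+
    then show ?thesis using T by (simp add: lambda_map_def)
  next
    case False
    \<comment> \<open>Outside the family both sides are \<open>undefined\<close>, by
      extensionality.\<close>
    then show ?thesis using p by (auto simp: lambda_map_def star_prod_def)
  qed
qed

lemma rho_lambda:
  assumes s: "s \<in> Star R"
  shows "rho_map R \<Theta> (lambda_map R \<Theta> s) = s"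
proof (rule Star_ext)
  show "rho_map R \<Theta> (lambda_map R \<Theta> s) \<in> Star R"
    using s lambda_map_star_prod rho_map_Star by blast
  fix I assume I: "I \<in> fractional_ideals R"
  show "rho_map R \<Theta> (lambda_map R \<Theta> s) I = s I"
  proof (cases "\<Theta> = {}")
    case True
    \<comment> \<open>The empty family forces \<open>R\<close> to be the whole field, whose only
      ideals are \<open>{0}\<close> and itself; both are fixed by \<open>s\<close>, matching the
      identity chosen as the empty meet.\<close>
    then have R: "R = UNIV" using Inter_members by simp
    have "I = {0} \<or> I = R"
    proof (rule disjCI)
      assume "I \<noteq> R"
      then obtain y where "y \<notin> I" using R by blast
      have "x = 0" if "x \<in> I" for x
      proof (rule ccontr)
        assume "x \<noteq> 0"
        then have "y = (y / x) * x" by simp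
        then show False using \<open>y \<notin> I\<close> \<open>x \<in> I\<close> fractional_submodule[OF I] R
          unfolding submodule_over_def by (metis UNIV_I)
      qed
      then show "I = {0}" using zero_in_fractional[OF I] by blast
    qed
    then have "s I = I" using Star_zero[OF s subring] Star_ring[OF s] by blast
    then show ?thesis using True I by (simp add: rho_map_def)
  next
    case False
    \<comment> \<open>The fractional ideal \<open>s I\<close> is then recovered from its own
      extensions.\<close>
    have "(\<Inter>T\<in>\<Theta>. lambda_map R \<Theta> s T (I \<cdot> T)) = (\<Inter>T\<in>\<Theta>. s I \<cdot> T)"
      using star_extension_mult[OF s _ I] by (simp add: lambda_map_def)
    then show ?thesis
      using rho_map_apply[OF I False] fractional_eq_Inter[OF False Star_fractional[OF s I]] by simp
  qed
qed (rule s)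

end

theorem theorem5p4:
  fixes R :: "'a::field set" and \<Theta> :: "'a set set"
  assumes "domain_with_quotient_field_UNIV R"
    and "jaffard_family R \<Theta>"
  shows "(\<forall>s\<in>Star R. \<forall>T\<in>\<Theta>. extendable R T s) \<and>
    bij_betw (lambda_map R \<Theta>) (Star R) (star_prod \<Theta>) \<and>
    monotone_on (Star R) (star_le R) (star_prod_le \<Theta>) (lambda_map R \<Theta>) \<and>
    bij_betw (rho_map R \<Theta>) (star_prod \<Theta>) (Star R) \<and>
    monotone_on (star_prod \<Theta>) (star_prod_le \<Theta>) (star_le R) (rho_map R \<Theta>)"
proof -
  interpret jaffard R \<Theta> using assms by unfold_locales
  have "bij_betw (lambda_map R \<Theta>) (Star R) (star_prod \<Theta>)"
    by (rule bij_betw_byWitness[where f' = "rho_map R \<Theta>"])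
      (auto simp: rho_lambda lambda_rho lambda_map_star_prod rho_map_Star)
  moreover have "bij_betw (rho_map R \<Theta>) (star_prod \<Theta>) (Star R)"
    by (rule bij_betw_byWitness[where f' = "lambda_map R \<Theta>"])
      (auto simp: rho_lambda lambda_rho lambda_map_star_prod rho_map_Star)
  ultimately show ?thesis
    using Star_extendable lambda_map_mono rho_map_mono by blast
qed

end
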